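(* Any complex nilpotent Lie algebra of dimension $n$ less than six is not rigid in $\mathcal{LR}_n$.
   Context: All algebras are finite-dimensional over $\mathbb{C}$. A (right) Leibniz algebra is a vector space $L$ with a bilinear bracket satisfying $[x,[y,z]]=[[x,y],z]-[[x,z],y]$ for all $x,y,z\in L$; every Lie algebra is a Leibniz algebra. $\mathcal{LR}_n$ is the variety of all $n$-dimensional solvable Leibniz algebra structures on $V=\mathbb{C}^n$ (those whose derived series reaches $0$), viewed as an algebraic subset of $\mathrm{Hom}(V\otimes V,V)$ with the Zariski topology. $\mathrm{GL}_n(\mathbb{C})$ acts by $(g*\lambda)(x,y)=g(\lambda(g^{-1}x,g^{-1}y))$, and the orbits are the isomorphism classes. An algebra is rigid in $\mathcal{LR}_n$ if its orbit is Zariski open in $\mathcal{LR}_n$.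
   Formalization: The dimension n is required to be at least 2: for n = 0 and n = 1 the variety LR_n is the single point 0, so the abelian Lie algebra is rigid there and the claim fails. *)

theory Defs
  imports "HOL-Analysis.Analysis"
begin

type_synonym 'n bracket = "complex ^ 'n \<Rightarrow> complex ^ 'n \<Rightarrow> complex ^ 'n"

text \<open>\<open>Hom(V \<otimes> V, V)\<close> for \<open>V = \<complex>\<^sup>n\<close>, with \<open>n = CARD('n)\<close>, is represented by the complex-bilinear
  maps. The linear structure is the complex one (scalar multiplication \<open>*s\<close>), not the real one that
  the type class \<open>real_vector\<close> puts on the same type.\<close>

definition bilinear_brackets :: "'n::finite bracket set" where
  "bilinear_brackets = {\<mu>. (\<forall>x. Vector_Spaces.linear (*s) (*s) (\<lambda>y. \<mu> x y)) \<and>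
                            (\<forall>y. Vector_Spaces.linear (*s) (*s) (\<lambda>x. \<mu> x y))}"

definition leibniz_algebra :: "'n::finite bracket \<Rightarrow> bool" where
  "leibniz_algebra \<mu> \<longleftrightarrow> \<mu> \<in> bilinear_brackets \<and>
     (\<forall>x y z. \<mu> x (\<mu> y z) = \<mu> (\<mu> x y) z - \<mu> (\<mu> x z) y)"

definition lie_algebra :: "'n::finite bracket \<Rightarrow> bool" where
  "lie_algebra \<mu> \<longleftrightarrow> \<mu> \<in> bilinear_brackets \<and> (\<forall>x. \<mu> x x = 0) \<and>
     (\<forall>x y z. \<mu> x (\<mu> y z) + \<mu> y (\<mu> z x) + \<mu> z (\<mu> x y) = 0)"

definition bracket_span ::
  "'n::finite bracket \<Rightarrow> (complex ^ 'n) set \<Rightarrow> (complex ^ 'n) set \<Rightarrow> (complex ^ 'n) set" where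
  "bracket_span \<mu> A B = vec.span {\<mu> x y | x y. x \<in> A \<and> y \<in> B}"

fun derived_series :: "'n::finite bracket \<Rightarrow> nat \<Rightarrow> (complex ^ 'n) set" where
  "derived_series \<mu> 0 = UNIV"
| "derived_series \<mu> (Suc k) = bracket_span \<mu> (derived_series \<mu> k) (derived_series \<mu> k)"

fun lower_central_series :: "'n::finite bracket \<Rightarrow> nat \<Rightarrow> (complex ^ 'n) set" where
  "lower_central_series \<mu> 0 = UNIV"
| "lower_central_series \<mu> (Suc k) = bracket_span \<mu> (lower_central_series \<mu> k) UNIV"

definition solvable_bracket :: "'n::finite bracket \<Rightarrow> bool" where
  "solvable_bracket \<mu> \<longleftrightarrow> (\<exists>k. derived_series \<mu> k = {0})"

definition nilpotent_bracket :: "'n::finite bracket \<Rightarrow> bool" where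
  "nilpotent_bracket \<mu> \<longleftrightarrow> (\<exists>k. lower_central_series \<mu> k = {0})"

definition LR :: "'n::finite bracket set" where
  "LR = {\<mu>. leibniz_algebra \<mu> \<and> solvable_bracket \<mu>}"

text \<open>The coordinates on \<open>Hom(V \<otimes> V, V)\<close> are the structure constants in the standard basis; the
  polynomial functions are the complex algebra of functions they generate.\<close>

definition structure_constant :: "'n::finite \<Rightarrow> 'n \<Rightarrow> 'n \<Rightarrow> 'n bracket \<Rightarrow> complex" where
  "structure_constant i j k \<mu> = \<mu> (axis i 1) (axis j 1) $ k"

inductive_set polynomial_functions :: "('n::finite bracket \<Rightarrow> complex) set" where
  coord: "structure_constant i j k \<in> polynomial_functions"
| const: "(\<lambda>_. c) \<in> polynomial_functions"
| add: "p \<in> polynomial_functions \<Longrightarrow> q \<in> polynomial_functions \<Longrightarrow>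
         (\<lambda>\<mu>. p \<mu> + q \<mu>) \<in> polynomial_functions"
| mult: "p \<in> polynomial_functions \<Longrightarrow> q \<in> polynomial_functions \<Longrightarrow>
         (\<lambda>\<mu>. p \<mu> * q \<mu>) \<in> polynomial_functions"

definition zero_locus :: "('n::finite bracket \<Rightarrow> complex) set \<Rightarrow> 'n bracket set" where
  "zero_locus P = {\<mu> \<in> bilinear_brackets. \<forall>p\<in>P. p \<mu> = 0}"

definition zariski_topology :: "'n::finite bracket topology" where
  "zariski_topology =
     topology (\<lambda>U. \<exists>P \<subseteq> polynomial_functions. U = bilinear_brackets - zero_locus P)"

lemma istopology_zariski:
  "istopology (\<lambda>U::'n::finite bracket set.
     \<exists>P \<subseteq> polynomial_functions. U = bilinear_brackets - zero_locus P)"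
  unfolding istopology_def
proof (intro conjI allI impI)
  fix S T :: "'n bracket set"
  assume "\<exists>P \<subseteq> polynomial_functions. S = bilinear_brackets - zero_locus P"
  then obtain P where P: "P \<subseteq> polynomial_functions" "S = bilinear_brackets - zero_locus P" by blast
  assume "\<exists>P \<subseteq> polynomial_functions. T = bilinear_brackets - zero_locus P"
  then obtain Q where Q: "Q \<subseteq> polynomial_functions" "T = bilinear_brackets - zero_locus Q" by blast
  define R where "R = {\<lambda>\<mu>. p \<mu> * q \<mu> | p q. p \<in> P \<and> q \<in> Q}"
  have "R \<subseteq> polynomial_functions"
    using P(1) Q(1) by (auto simp: R_def intro!: polynomial_functions.mult)
  moreover have "S \<inter> T = bilinear_brackets - zero_locus R"
    unfolding P(2) Q(2) zero_locus_def R_def by fastforce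
  ultimately show "\<exists>P \<subseteq> polynomial_functions. S \<inter> T = bilinear_brackets - zero_locus P" by blast
next
  fix K :: "'n bracket set set"
  assume "\<forall>S\<in>K. \<exists>P \<subseteq> polynomial_functions. S = bilinear_brackets - zero_locus P"
  then obtain f where f: "\<And>S. S \<in> K \<Longrightarrow> f S \<subseteq> polynomial_functions"
    "\<And>S. S \<in> K \<Longrightarrow> S = bilinear_brackets - zero_locus (f S)" by metis
  have "\<Union>K = (\<Union>S\<in>K. bilinear_brackets - zero_locus (f S))"
    using f(2) by auto
  also have "\<dots> = bilinear_brackets - zero_locus (\<Union>S\<in>K. f S)"
    by (auto simp: zero_locus_def)
  finally show "\<exists>P \<subseteq> polynomial_functions. \<Union>K = bilinear_brackets - zero_locus P"
    using f(1) by (intro exI[of _ "\<Union>S\<in>K. f S"]) auto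
qed

lemma openin_zariski:
  "openin zariski_topology U \<longleftrightarrow>
     (\<exists>P \<subseteq> polynomial_functions. U = bilinear_brackets - zero_locus P)"
  unfolding zariski_topology_def topology_inverse'[OF istopology_zariski] ..

lemma topspace_zariski: "topspace zariski_topology = bilinear_brackets"
proof -
  have "openin zariski_topology bilinear_brackets"
    unfolding openin_zariski
    by (intro exI[of _ "{\<lambda>_. 1}"]) (auto simp: zero_locus_def intro: polynomial_functions.const)
  then show ?thesis
    using openin_zariski[of "topspace zariski_topology"] by (auto dest: openin_subset)
qed

definition gl_action :: "complex ^ 'n ^ 'n \<Rightarrow> 'n::finite bracket \<Rightarrow> 'n bracket" where
  "gl_action g \<mu> = (\<lambda>x y. g *v \<mu> (matrix_inv g *v x) (matrix_inv g *v y))"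

definition gl_orbit :: "'n::finite bracket \<Rightarrow> 'n bracket set" where
  "gl_orbit \<mu> = {gl_action g \<mu> | g. invertible g}"

definition rigid :: "'n::finite bracket \<Rightarrow> bool" where
  "rigid \<mu> \<longleftrightarrow> openin (subtopology zariski_topology LR) (gl_orbit \<mu>)"

lemma lie_algebra_imp_leibniz_algebra:
  assumes "lie_algebra \<mu>"
  shows "leibniz_algebra \<mu>"
proof -
  have bil: "\<mu> \<in> bilinear_brackets" and alt: "\<And>x. \<mu> x x = 0"
    and jac: "\<And>x y z. \<mu> x (\<mu> y z) + \<mu> y (\<mu> z x) + \<mu> z (\<mu> x y) = 0"
    using assms by (auto simp: lie_algebra_def)
  have addr: "\<mu> x (y + z) = \<mu> x y + \<mu> x z" and addl: "\<mu> (x + y) z = \<mu> x z + \<mu> y z" for x y z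
    using bil by (simp_all add: bilinear_brackets_def Vector_Spaces.linear_iff)
  have anti: "\<mu> y x = - \<mu> x y" for x y
  proof -
    have "0 = \<mu> (x + y) (x + y)" by (simp only: alt)
    also have "\<dots> = (\<mu> x x + \<mu> x y) + (\<mu> y x + \<mu> y y)" by (simp add: addl addr)
    also have "\<dots> = \<mu> x y + \<mu> y x" by (simp add: alt)
    finally show ?thesis by (metis eq_neg_iff_add_eq_0 add.commute)
  qed
  have "\<mu> x 0 = 0" for x using addr[of x 0 0] by simp
  then have negr: "\<mu> x (- y) = - \<mu> x y" for x y
    using addr[of x "- y" y] by (simp add: eq_neg_iff_add_eq_0)
  have "\<mu> x (\<mu> y z) = \<mu> (\<mu> x y) z - \<mu> (\<mu> x z) y" for x y z
  proof -
    have "\<mu> y (\<mu> z x) = \<mu> y (- \<mu> x z)" by (simp only: anti[of z x])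
    also have "\<dots> = \<mu> (\<mu> x z) y" by (simp add: negr anti[of y "\<mu> x z"])
    finally have "\<mu> y (\<mu> z x) = \<mu> (\<mu> x z) y" .
    moreover have "\<mu> z (\<mu> x y) = - \<mu> (\<mu> x y) z" by (rule anti)
    ultimately have "\<mu> x (\<mu> y z) + \<mu> (\<mu> x z) y + - \<mu> (\<mu> x y) z = 0"
      using jac[of x y z] by (simp only:)
    then show ?thesis by (simp add: algebra_simps)
  qed
  then show ?thesis using bil by (simp add: leibniz_algebra_def)
qed

lemma nilpotent_lie_algebra_in_LR:
  assumes "lie_algebra \<mu>" "nilpotent_bracket \<mu>"
  shows "\<mu> \<in> LR"
proof -
  have sub: "derived_series \<mu> k \<subseteq> lower_central_series \<mu> k" for k
  proof (induction k)
    case (Suc k)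
    then show ?case
      unfolding derived_series.simps lower_central_series.simps bracket_span_def
      by (intro vec.span_mono) blast
  qed simp
  have "0 \<in> derived_series \<mu> k" for k
    by (cases k) (auto simp: bracket_span_def vec.span_zero)
  then have "solvable_bracket \<mu>"
    using assms(2) sub unfolding solvable_bracket_def nilpotent_bracket_def by blast
  then show ?thesis
    using lie_algebra_imp_leibniz_algebra[OF assms(1)] by (simp add: LR_def)
qed

text \<open>In dimension one the variety \<open>LR\<close> is the single point \<open>0\<close>, so the abelian algebra is rigid
  there; statements of non-rigidity need dimension at least two.\<close>

lemma rigid_dimension_one:
  fixes \<mu> :: "'n::finite bracket"
  assumes "CARD('n) = 1" "lie_algebra \<mu>" "nilpotent_bracket \<mu>"
  shows "rigid \<mu>"
proof -
  obtain i :: 'n where i: "UNIV = {i}"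
    using assms(1) by (auto simp: card_1_singleton_iff)
  have vec: "x = x $ i *s axis i 1" for x :: "complex ^ 'n"
    using i by (auto simp: vec_eq_iff axis_def)
  have zero: "\<nu> = (\<lambda>x y. 0)" if "\<nu> \<in> LR" for \<nu> :: "'n bracket"
  proof -
    have bil: "\<nu> \<in> bilinear_brackets"
      and leib: "\<And>x y z. \<nu> x (\<nu> y z) = \<nu> (\<nu> x y) z - \<nu> (\<nu> x z) y"
      using that by (auto simp: LR_def leibniz_algebra_def)
    have sr: "\<nu> x (c *s y) = c *s \<nu> x y" and sl: "\<nu> (c *s x) y = c *s \<nu> x y" for x y c
      using bil by (simp_all add: bilinear_brackets_def Vector_Spaces.linear_iff)
    let ?e = "axis i 1 :: complex ^ 'n"
    define c where "c = \<nu> ?e ?e $ i"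
    have c: "\<nu> ?e ?e = c *s ?e" unfolding c_def by (rule vec)
    have "\<nu> ?e (\<nu> ?e ?e) = 0" using leib[of ?e ?e ?e] by simp
    then have "(c * c) *s ?e = 0" unfolding c sr by (simp add: c)
    then have "c = 0" by (simp add: axis_eq_0_iff)
    then have "\<nu> x y = 0" for x y
    proof -
      have "\<nu> x y = \<nu> (x $ i *s ?e) (y $ i *s ?e)" by (simp only: vec[symmetric])
      also have "\<dots> = 0" by (simp only: sr sl c \<open>c = 0\<close>) simp
      finally show ?thesis .
    qed
    then show ?thesis by blast
  qed
  have \<mu>: "\<mu> \<in> LR" using nilpotent_lie_algebra_in_LR[OF assms(2,3)] .
  have "gl_action g \<mu> = \<mu>" for g :: "complex ^ 'n ^ 'n"
    using zero[OF \<mu>] by (simp add: gl_action_def)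
  moreover have "invertible (mat 1 :: complex ^ 'n ^ 'n)"
    unfolding invertible_def by (intro exI[of _ "mat 1"]) simp
  ultimately have "gl_orbit \<mu> = {\<mu>}" unfolding gl_orbit_def by auto
  moreover have "LR = {\<mu>}" using \<mu> zero by blast
  moreover have "\<mu> \<in> bilinear_brackets" using assms(2) by (simp add: lie_algebra_def)
  ultimately have "gl_orbit \<mu> = topspace (subtopology zariski_topology LR)"
    by (auto simp: topspace_subtopology topspace_zariski)
  then show ?thesis unfolding rigid_def by (metis openin_topspace)
qed

end

theory Submission
  imports Defs
begin

text \<open>A nilpotent Lie algebra of dimension at least two is the limit, along a line, of Leibniz algebras
  that are not Lie algebras, and these cannot lie in its orbit.

  Let \<open>f\<close> be a nonzero linear functional that vanishes on all brackets, and let \<open>z \<noteq> 0\<close> be a central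
  vector with \<open>f z = 0\<close>. In each of the iterated brackets that occur in the Leibniz identity, the
  perturbation \<open>\<mu>\<^sub>t x y = \<mu> x y + t f(x) f(y) z\<close> contributes nothing: the inner perturbation has its
  value in the centre and in the kernel of \<open>f\<close>, and the outer one vanishes on brackets. Hence \<open>\<mu>\<^sub>t\<close> is a
  Leibniz bracket for every \<open>t\<close> (lemma \<open>leibniz_algebra_square_deformation\<close>). It agrees with \<open>\<mu>\<close> on the
  kernel of \<open>f\<close>, which contains its derived algebra, so that it is solvable. But
  \<open>\<mu>\<^sub>t x x = t f(x)\<^sup>2 z\<close> is nonzero for suitable \<open>x\<close> when \<open>t \<noteq> 0\<close>, whereas all brackets in the orbit of
  \<open>\<mu>\<close> are alternating. An open orbit would have to contain \<open>\<mu>\<^sub>t\<close> for all small \<open>t\<close>, because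
  polynomial functions are continuous along the line (lemma \<open>rigid_line_meets_orbit\<close>).

  Nilpotency provides \<open>f\<close> and \<open>z\<close> (lemma \<open>nilpotent_central_vector_and_functional\<close>): the last nonzero
  term of the lower central series is central, and it lies in the derived algebra unless the algebra
  is abelian; in both cases \<open>z\<close> and the brackets together span a proper subspace.\<close>

section \<open>Open orbits and lines of brackets\<close>

lemma continuous_polynomial_function_line:
  assumes "p \<in> polynomial_functions"
  shows "continuous_on UNIV (\<lambda>t::complex. p (\<lambda>x y. \<mu> x y + t *s \<phi> x y))"
  using assms
  by induction (auto simp: structure_constant_def intro!: continuous_intros)

lemma self_in_gl_orbit: "\<mu> \<in> gl_orbit \<mu>"
proof -
  have inv: "invertible (mat 1 :: complex ^ 'a ^ 'a)"
    unfolding invertible_def by (intro exI[of _ "mat 1"]) simp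
  then have "matrix_inv (mat 1 :: complex ^ 'a ^ 'a) = mat 1"
    unfolding matrix_inv_def by simp
  then have "gl_action (mat 1) \<mu> = \<mu>"
    by (simp add: gl_action_def)
  then show ?thesis
    unfolding gl_orbit_def using inv by force
qed

text \<open>Some polynomial of the system that cuts out the complement of the orbit is nonzero at \<open>\<mu>\<close>, and by
  continuity it stays nonzero at nearby points of the line.\<close>

lemma rigid_line_meets_orbit:
  fixes \<mu> \<phi> :: "'n::finite bracket"
  assumes "rigid \<mu>" and line: "\<And>t. (\<lambda>x y. \<mu> x y + t *s \<phi> x y) \<in> LR"
  obtains t where "t \<noteq> 0" "(\<lambda>x y. \<mu> x y + t *s \<phi> x y) \<in> gl_orbit \<mu>"
proof -
  let ?\<nu> = "\<lambda>t x y. \<mu> x y + t *s \<phi> x y"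
  obtain U where "openin zariski_topology U" and U: "gl_orbit \<mu> = U \<inter> LR"
    using \<open>rigid \<mu>\<close> unfolding rigid_def openin_subtopology by blast
  then obtain P where P: "P \<subseteq> polynomial_functions" "U = bilinear_brackets - zero_locus P"
    unfolding openin_zariski by blast
  have "\<mu> \<in> U"
    using self_in_gl_orbit U by blast
  then obtain p where p: "p \<in> P" "p \<mu> \<noteq> 0"
    unfolding P(2) zero_locus_def by blast
  have "continuous_on UNIV (\<lambda>t. p (?\<nu> t))"
    using continuous_polynomial_function_line p(1) P(1) by blast
  then have "((\<lambda>t. p (?\<nu> t)) \<longlongrightarrow> p (?\<nu> 0)) (at 0)"
    by (simp only: continuous_on_eq_continuous_at[OF open_UNIV] isCont_def) blast
  then have "\<forall>\<^sub>F t in at 0. p (?\<nu> t) \<noteq> 0"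
    by (rule tendsto_imp_eventually_ne) (use p(2) in simp)
  then have "\<forall>\<^sub>F t in at 0. t \<noteq> 0 \<and> p (?\<nu> t) \<noteq> 0"
    by (simp add: eventually_conj_iff eventually_neq_at_within)
  then obtain t where t: "t \<noteq> 0" "p (?\<nu> t) \<noteq> 0"
    using eventually_happens'[OF at_neq_bot] by blast
  have "?\<nu> t \<in> bilinear_brackets"
    using line[of t] by (simp add: LR_def leibniz_algebra_def)
  then have "?\<nu> t \<in> gl_orbit \<mu>"
    using p(1) t(2) line[of t] unfolding U P(2) zero_locus_def by blast
  with t(1) show ?thesis
    using that by blast
qed

lemma alternating_gl_orbit:
  assumes "\<nu> \<in> gl_orbit \<mu>" and "\<And>x. \<mu> x x = 0"
  shows "\<nu> x x = 0"
  using assms by (auto simp: gl_orbit_def gl_action_def)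

section \<open>Deforming by the square of a linear functional\<close>

text \<open>The Leibniz identity for the deformed bracket holds because all iterated brackets are those of
  \<open>\<mu>\<close>: the vector \<open>z\<close> annihilates and is annihilated by everything, and \<open>f\<close> kills brackets and \<open>z\<close>.\<close>

lemma leibniz_algebra_square_deformation:
  fixes \<mu> :: "'n::finite bracket" and f :: "complex ^ 'n \<Rightarrow> complex"
  assumes leib: "leibniz_algebra \<mu>" and f: "Vector_Spaces.linear (*s) (*) f"
    and f_bracket: "\<And>x y. f (\<mu> x y) = 0" and "f z = 0"
    and central: "\<And>x. \<mu> x z = 0" "\<And>x. \<mu> z x = 0"
  shows "leibniz_algebra (\<lambda>x y. \<mu> x y + t *s ((f x * f y) *s z))"
proof -
  have bil: "\<mu> \<in> bilinear_brackets"
    and id: "\<And>x y w. \<mu> x (\<mu> y w) = \<mu> (\<mu> x y) w - \<mu> (\<mu> x w) y"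
    using leib by (auto simp: leibniz_algebra_def)
  have \<mu>: "\<mu> x (y + w) = \<mu> x y + \<mu> x w" "\<mu> (x + y) w = \<mu> x w + \<mu> y w"
    "\<mu> x (c *s y) = c *s \<mu> x y" "\<mu> (c *s x) y = c *s \<mu> x y" for x y w c
    using bil by (simp_all add: bilinear_brackets_def Vector_Spaces.linear_iff)
  have f': "f (x + y) = f x + f y" "f (c *s x) = c * f x" for x y c
    using f by (simp_all add: Vector_Spaces.linear_iff)
  have "(\<lambda>x y. \<mu> x y + t *s ((f x * f y) *s z)) \<in> bilinear_brackets"
    unfolding bilinear_brackets_def Vector_Spaces.linear_iff
    by (simp add: \<mu> f' vec.vector_space_axioms vec_eq_iff algebra_simps)
  then show ?thesis
    unfolding leibniz_algebra_def
    by (simp add: \<mu> f' f_bracket \<open>f z = 0\<close> central id)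
qed

text \<open>Since \<open>\<nu>\<close> and \<open>\<mu>\<close> agree on the kernel of \<open>f\<close>, which contains all values of \<open>\<nu>\<close>, the derived
  series of \<open>\<nu>\<close> lags behind that of \<open>\<mu>\<close> by at most one step.\<close>

lemma solvable_bracket_agree_on_kernel:
  fixes \<mu> \<nu> :: "'n::finite bracket" and f :: "complex ^ 'n \<Rightarrow> complex"
  assumes "solvable_bracket \<mu>" and f: "Vector_Spaces.linear (*s) (*) f"
    and kernel: "\<And>x y. f (\<nu> x y) = 0"
    and agree: "\<And>x y. f x = 0 \<Longrightarrow> f y = 0 \<Longrightarrow> \<nu> x y = \<mu> x y"
  shows "solvable_bracket \<nu>"
proof -
  interpret f: Vector_Spaces.linear "(*s)" "(*)" f
    by (rule f)
  have ker: "derived_series \<nu> (Suc k) \<subseteq> {x. f x = 0}" for k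
    unfolding derived_series.simps bracket_span_def
    by (intro vec.span_minimal f.subspace_kernel) (auto simp: kernel)
  have sub: "derived_series \<nu> (Suc k) \<subseteq> derived_series \<mu> k" for k
  proof (induction k)
    case (Suc k)
    have "{\<nu> x y | x y. x \<in> derived_series \<nu> (Suc k) \<and> y \<in> derived_series \<nu> (Suc k)}
      \<subseteq> {\<mu> x y | x y. x \<in> derived_series \<mu> k \<and> y \<in> derived_series \<mu> k}"
      using Suc ker[of k] agree by blast
    then show ?case
      unfolding derived_series.simps(2)[of \<nu> "Suc k"] derived_series.simps(2)[of \<mu> k]
        bracket_span_def by (rule vec.span_mono)
  qed simp
  have "0 \<in> derived_series \<nu> k" for k
    by (cases k) (auto simp: bracket_span_def vec.span_zero)
  then show ?thesis
    using assms(1) sub unfolding solvable_bracket_def by blast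
qed

section \<open>Central vectors and functionals on a nilpotent Lie algebra\<close>

lemma linear_functional_vanishing_on_proper_subspace:
  fixes W :: "(complex ^ 'n::finite) set"
  assumes "vec.span W \<noteq> UNIV"
  obtains f :: "complex ^ 'n \<Rightarrow> complex" and v
  where "Vector_Spaces.linear (*s) (*) f" "\<And>x. x \<in> W \<Longrightarrow> f x = 0" "f v \<noteq> 0"
proof -
  obtain v where v: "v \<notin> vec.span W"
    using assms by blast
  obtain B where B: "vec.independent B" "W \<subseteq> vec.span B" "B \<subseteq> W"
    using vec.maximal_independent_subset by metis
  then have span: "vec.span B = vec.span W"
    using vec.span_base by (auto simp: vec.span_eq)
  then have "vec.independent (insert v B)"
    using B(1) v by (simp add: vec.independent_insert)
  \<comment> \<open>An endomorphism that kills \<open>W\<close> but not \<open>v\<close>; one of its coordinates is the functional.\<close>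
  then obtain g :: "complex ^ 'n \<Rightarrow> complex ^ 'n" where g: "Vector_Spaces.linear (*s) (*s) g"
    "\<forall>x\<in>insert v B. g x = (if x = v then v else 0)"
    using vec.linear_independent_extend[of _ "\<lambda>x. if x = v then v else 0"] by blast
  have "v \<noteq> 0"
    using v vec.span_zero by metis
  then obtain i where i: "v $ i \<noteq> 0"
    by (auto simp: vec_eq_iff)
  have "v \<notin> B"
    using v span vec.span_base by blast
  then have "\<forall>x\<in>B. g x = 0"
    using g(2) by auto
  then have zero: "g x = 0" if "x \<in> W" for x
    using that B(2) vec.linear_eq_0_on_span[OF g(1)] by blast
  have "Vector_Spaces.linear (*s) (*) (\<lambda>x. g x $ i)"
    using g(1)
    by (simp add: Vector_Spaces.linear_iff vec.vector_space_axioms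
        vector_space_over_itself.vector_space_axioms)
  then show ?thesis
    using that[of "\<lambda>x. g x $ i" v] zero g(2) i by auto
qed

lemma lie_algebra_antisymmetric:
  assumes "lie_algebra \<mu>"
  shows "\<mu> y x = - \<mu> x y"
proof -
  have bil: "\<mu> \<in> bilinear_brackets" and alt: "\<And>x. \<mu> x x = 0"
    using assms by (auto simp: lie_algebra_def)
  have "\<mu> (x + y) (x + y) = (\<mu> x x + \<mu> x y) + (\<mu> y x + \<mu> y y)"
    using bil by (simp add: bilinear_brackets_def Vector_Spaces.linear_iff)
  then show ?thesis
    by (simp add: alt eq_neg_iff_add_eq_0 add.commute)
qed

lemma lower_central_series_proper:
  fixes \<mu> :: "'n::finite bracket"
  assumes "nilpotent_bracket \<mu>"
  shows "lower_central_series \<mu> 1 \<noteq> UNIV"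
proof
  assume perfect: "lower_central_series \<mu> 1 = UNIV"
  have "lower_central_series \<mu> k = UNIV" for k
    by (induction k) (use perfect in auto)
  then have "(UNIV :: (complex ^ 'n) set) = {0}"
    using assms unfolding nilpotent_bracket_def by metis
  moreover have "axis undefined 1 \<noteq> (0 :: complex ^ 'n)"
    by (simp add: axis_eq_0_iff)
  ultimately show False
    by blast
qed

text \<open>The vector \<open>z\<close> is taken from the last nonzero term of the lower central series. If that term is
  not the whole algebra, then it lies in the derived algebra, which is proper by nilpotency.
  Otherwise the algebra is abelian, and then the brackets and \<open>z\<close> span a line, which is proper because
  the dimension is at least two.\<close>

lemma nilpotent_central_vector_and_functional:
  fixes \<mu> :: "'n::finite bracket"
  assumes "2 \<le> CARD('n)" and lie: "lie_algebra \<mu>" and nil: "nilpotent_bracket \<mu>"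
  obtains f v z where "Vector_Spaces.linear (*s) (*) f" "\<And>x y. f (\<mu> x y) = 0" "f v \<noteq> 0"
    "z \<noteq> 0" "f z = 0" "\<And>x. \<mu> x z = 0" "\<And>x. \<mu> z x = 0"
proof -
  let ?C = "lower_central_series \<mu>"
  define k where "k = (LEAST k. ?C k = {0})"
  have k: "?C k = {0}"
    using nil unfolding nilpotent_bracket_def k_def by (rule LeastI_ex)
  have "axis undefined 1 \<in> ?C 0" "axis undefined 1 \<noteq> (0 :: complex ^ 'n)"
    by (simp_all add: axis_eq_0_iff)
  then have "?C 0 \<noteq> {0}"
    by blast
  then obtain m where m: "k = Suc m"
    using k by (cases k) auto
  then have "?C m \<noteq> {0}"
    using not_less_Least[of m "\<lambda>k. ?C k = {0}"] by (simp add: k_def)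
  moreover have "0 \<in> ?C m"
    by (cases m) (auto simp: bracket_span_def vec.span_zero)
  ultimately obtain z where z: "z \<in> ?C m" "z \<noteq> 0"
    by blast
  have "\<mu> z x \<in> ?C (Suc m)" for x
    using z(1) by (auto simp: bracket_span_def intro!: vec.span_base)
  then have left: "\<mu> z x = 0" for x
    using k m by blast
  then have right: "\<mu> x z = 0" for x
    using lie_algebra_antisymmetric[OF lie, of x z] by simp
  let ?D = "{\<mu> x y | x y. True}"
  have C1: "?C 1 = vec.span ?D"
    by (simp add: bracket_span_def)
  have proper: "vec.span (insert z ?D) \<noteq> UNIV"
  proof (cases m)
    case 0
    then have "?D \<subseteq> {0}"
      using k m C1 vec.span_superset[of ?D] by auto
    then have "insert z ?D \<subseteq> {z, 0}"
      by blast
    also have "\<dots> \<subseteq> vec.span {z}"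
      by (simp add: vec.span_base vec.span_zero)
    finally have "insert z ?D \<subseteq> vec.span {z}" .
    then have "vec.dim (insert z ?D) \<le> 1"
      using vec.dim_le_card[of "insert z ?D" "{z}"] by simp
    then have "vec.dim (vec.span (insert z ?D)) < CARD('n)"
      using assms(1) by (simp add: vec.dim_span)
    then show ?thesis
      by (metis vec_dim_card nat_neq_iff)
  next
    case (Suc j)
    then have "z \<in> vec.span ?D"
      using z(1) vec.span_mono[of "{\<mu> x y | x y. x \<in> ?C j \<and> y \<in> UNIV}" ?D]
      by (auto simp: bracket_span_def)
    then show ?thesis
      using lower_central_series_proper[OF nil] C1 by (simp add: vec.span_redundant)
  qed
  obtain f v where f: "Vector_Spaces.linear (*s) (*) f" "\<And>x. x \<in> insert z ?D \<Longrightarrow> f x = 0" "f v \<noteq> 0"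
    using linear_functional_vanishing_on_proper_subspace[OF proper] by blast
  show ?thesis
    by (rule that[OF f(1) _ f(3) z(2) _ right left]) (use f(2) in blast)+
qed

section \<open>Non-rigidity\<close>

theorem theorem3p11:
  fixes \<mu> :: "'n::finite bracket"
  assumes "2 \<le> CARD('n)" and "CARD('n) < 6"
    and "lie_algebra \<mu>" and "nilpotent_bracket \<mu>"
  shows "\<not> rigid \<mu>"
proof
  assume "rigid \<mu>"
  obtain f v z where f: "Vector_Spaces.linear (*s) (*) f" "\<And>x y. f (\<mu> x y) = 0" "f v \<noteq> 0"
    and z: "z \<noteq> 0" "f z = 0" "\<And>x. \<mu> x z = 0" "\<And>x. \<mu> z x = 0"
    by (rule nilpotent_central_vector_and_functional[OF assms(1,3,4)], rule that)
  let ?\<nu> = "\<lambda>t x y. \<mu> x y + t *s ((f x * f y) *s z)"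
  have \<mu>: "leibniz_algebra \<mu>" "solvable_bracket \<mu>"
    using nilpotent_lie_algebra_in_LR assms(3,4) by (auto simp: LR_def)
  have "f (?\<nu> t x y) = 0" for t x y
    using f(1,2) z(2) by (simp add: Vector_Spaces.linear_iff)
  then have line: "?\<nu> t \<in> LR" for t
    unfolding LR_def
    using leibniz_algebra_square_deformation[OF \<mu>(1) f(1,2) z(2,3,4), of t]
      solvable_bracket_agree_on_kernel[OF \<mu>(2) f(1), of "?\<nu> t"] by simp
  obtain t where "t \<noteq> 0" "?\<nu> t \<in> gl_orbit \<mu>"
    by (rule rigid_line_meets_orbit[OF \<open>rigid \<mu>\<close> line])
  then have "?\<nu> t v v = 0"
    using alternating_gl_orbit assms(3) unfolding lie_algebra_def by blast
  then show False
    using assms(3) \<open>t \<noteq> 0\<close> f(3) z(1) by (simp add: lie_algebra_def vec.scale_eq_0_iff)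
qed

end
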